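(* There is a bijection between $\mathbb{R}$ and the set $\mathbb{R}_{\mathrm{Co}}$ of Conway reals, given by the following two maps $x\mapsto r(x)$ and $r\mapsto x(r)$, which are inverse to each other. (1) Let $x\in\mathbb{R}_{\mathrm{Co}}$ with $0\notin x$ (so $\min(x)\in\mathbb{N}$, $\min(x)>0$), and let $X=x\cap\mathbb{N}$. Put $$r(x):=-\min(x)+\sum_{m\in X,\ m>\min(x)}\left(\tfrac12\right)^{m-\min(x)} .$$ If $0\in x$, put $r(x):=-r(x^\sharp)$ (in particular $r(\{0\})=0$). (2) Let $r\in\mathbb{R}$, $r<0$, and expand $r=-r_0+\sum_{k=1}^\infty a_k2^{-k}$ with $r_0\in\mathbb{N}$, $r_0\ge 1$, $a_k\in\{0,1\}$, where expansions with $a_k=1$ for all sufficiently large $k$ are not allowed (they are always replaced by the corresponding finite sum). If the expansion is finite (only finitely many $a_k=1$), put $x(r)=\{r_0\}\cup\{r_0+k\mid k\ge 1,\ a_k=1\}$; if it is infinite, put $x(r)=\{r_0\}\cup\{r_0+k\mid k\ge 1,\ a_k=1\}\cup\{\omega\}$. If $r>0$, put $x(r)=(x(-r))^\sharp$; and $x(0)=\{0\}$. Under this correspondence, the short numbers correspond to the ring $\mathbb{Z}[\frac12]$ of dyadic rationals, the finite Conway ordinals correspond to $\mathbb{N}$ (namely $n_{\mathrm{Co}}\leftrightarrow n$), and $\{n\}$ corresponds to $-n$ for all $n\in\mathbb{N}$. Ordinal arithmetic (sum and product) on the finite Conway ordinals corresponds to the usual arithmetic on $\mathbb{N}$.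
   Context: Ordinals are von Neumann ordinals; $\mathbb{N}=\omega$ contains $0$. A (Conway) number is a set $x$ of ordinals having a maximal element, denoted $\mathrm{b}(x)$ (its birthday). The opposite of a number $x$ is $x^\sharp:=\{\alpha\mid\alpha<\mathrm{b}(x),\ \alpha\notin x\}\cup\{\mathrm{b}(x)\}$. A short number is a non-empty finite subset of $\mathbb{N}$. A long Conway real is a number of the form $X\cup\{\omega\}$ with $X\subset\mathbb{N}$ both infinite and co-infinite in $\mathbb{N}$. A Conway real is a short number or a long Conway real; $\mathbb{R}_{\mathrm{Co}}$ is the set of all Conway reals. For an ordinal $\alpha$, the Conway ordinal is $\alpha_{\mathrm{Co}}:=\alpha+1=\{\beta\mid\beta\le\alpha\}$; the ordinal operations on Conway ordinals are those transported from ordinals via $\alpha\mapsto\alpha_{\mathrm{Co}}$. *)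

theory Defs
  imports "HOL-Analysis.Analysis"
begin

text \<open>
  HOL has no type of all ordinals.  We use the type of all countable ordinals, that is, those
  below the first uncountable one: it is an initial segment of the ordinals, contains \<open>\<omega>\<close>, is
  closed under ordinal sum and product, and contains all ordinals occurring in Conway reals.
\<close>

typedef ordinal = "Field (cardSuc natLeq)"
proof -
  have "infinite (Field (cardSuc natLeq))"
    using cardSuc_finite[OF natLeq_Card_order] by (simp add: Field_natLeq)
  then show ?thesis
    by (metis ex_in_conv finite.emptyI)
qed

instantiation ordinal :: linorder
begin

definition less_eq_ordinal :: "ordinal \<Rightarrow> ordinal \<Rightarrow> bool" where
  "\<alpha> \<le> \<beta> \<longleftrightarrow> (Rep_ordinal \<alpha>, Rep_ordinal \<beta>) \<in> cardSuc natLeq"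

definition less_ordinal :: "ordinal \<Rightarrow> ordinal \<Rightarrow> bool" where
  "(\<alpha>::ordinal) < \<beta> \<longleftrightarrow> \<alpha> \<le> \<beta> \<and> \<alpha> \<noteq> \<beta>"

instance
proof -
  have wo: "Well_order (cardSuc natLeq)"
    using cardSuc_Card_order[OF natLeq_Card_order] by (simp add: card_order_on_def)
  then have lin: "Linear_order (cardSuc natLeq)"
    by (simp add: well_order_on_def)
  then have refl: "\<And>\<alpha>. (Rep_ordinal \<alpha>, Rep_ordinal \<alpha>) \<in> cardSuc natLeq"
    and trans: "trans (cardSuc natLeq)" and anti: "antisym (cardSuc natLeq)"
    and total: "total_on (Field (cardSuc natLeq)) (cardSuc natLeq)"
    using Rep_ordinal
    by (auto simp: linear_order_on_def partial_order_on_def preorder_on_def refl_on_def)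
  have antisym: "\<alpha> = \<beta>" if "\<alpha> \<le> \<beta>" "\<beta> \<le> \<alpha>" for \<alpha> \<beta> :: ordinal
    using that anti unfolding less_eq_ordinal_def antisym_def by (metis Rep_ordinal_inject)
  show "OFCLASS(ordinal, linorder_class)"
  proof (standard, goal_cases)
    case (1 \<alpha> \<beta>) then show ?case using antisym by (auto simp: less_ordinal_def)
  next
    case (2 \<alpha>) then show ?case using refl by (simp add: less_eq_ordinal_def)
  next
    case (3 \<alpha> \<beta> \<gamma>) then show ?case
      using trans unfolding less_eq_ordinal_def trans_def by blast
  next
    case (4 \<alpha> \<beta>) then show ?case using antisym by blast
  next
    case (5 \<alpha> \<beta>) then show ?case
      using total refl Rep_ordinal unfolding less_eq_ordinal_def total_on_def by metis
  qed
qed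

end

instance ordinal :: wellorder
proof
  fix P :: "ordinal \<Rightarrow> bool" and \<alpha>
  assume step: "\<And>\<beta>. (\<And>\<gamma>. \<gamma> < \<beta> \<Longrightarrow> P \<gamma>) \<Longrightarrow> P \<beta>"
  have "wf (cardSuc natLeq - Id)"
    using cardSuc_Card_order[OF natLeq_Card_order]
    by (simp add: card_order_on_def well_order_on_def)
  then have "wf (inv_image (cardSuc natLeq - Id) Rep_ordinal)"
    by (rule wf_inv_image)
  moreover have "{(\<beta>, \<gamma>). \<beta> < \<gamma>} \<subseteq> inv_image (cardSuc natLeq - Id) Rep_ordinal"
    by (auto simp: less_ordinal_def less_eq_ordinal_def Rep_ordinal_inject)
  ultimately have "wf {(\<beta>, \<gamma>::ordinal). \<beta> < \<gamma>}"
    by (rule wf_subset)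
  then show "P \<alpha>"
    by (induction \<alpha> rule: wf_induct_rule) (use step in blast)
qed

primrec ord_of_nat :: "nat \<Rightarrow> ordinal" where
  "ord_of_nat 0 = (LEAST \<alpha>. True)"
| "ord_of_nat (Suc n) = (LEAST \<alpha>. ord_of_nat n < \<alpha>)"

definition omega :: ordinal where
  "omega = (LEAST \<alpha>. \<forall>n. ord_of_nat n < \<alpha>)"

text \<open>
  Well-founded recursion on the second argument, with the three usual clauses (zero, successor,
  limit) in one: \<open>\<alpha> + \<beta>\<close> is the least ordinal that is \<open>\<ge> \<alpha>\<close> and \<open>> \<alpha> + \<gamma>\<close> for all \<open>\<gamma> < \<beta>\<close>, and
  \<open>\<alpha> \<cdot> \<beta>\<close> is the supremum of the \<open>\<alpha> \<cdot> \<gamma> + \<alpha>\<close> for \<open>\<gamma> < \<beta>\<close>.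
\<close>

definition ord_add :: "ordinal \<Rightarrow> ordinal \<Rightarrow> ordinal" where
  "ord_add \<alpha> = wfrec {(\<gamma>, \<beta>). \<gamma> < \<beta>} (\<lambda>f \<beta>. LEAST \<delta>. \<alpha> \<le> \<delta> \<and> (\<forall>\<gamma><\<beta>. f \<gamma> < \<delta>))"

definition ord_mult :: "ordinal \<Rightarrow> ordinal \<Rightarrow> ordinal" where
  "ord_mult \<alpha> = wfrec {(\<gamma>, \<beta>). \<gamma> < \<beta>} (\<lambda>f \<beta>. LEAST \<delta>. \<forall>\<gamma><\<beta>. ord_add (f \<gamma>) \<alpha> \<le> \<delta>)"

definition conway_number :: "ordinal set \<Rightarrow> bool" where
  "conway_number x \<longleftrightarrow> (\<exists>\<beta>\<in>x. \<forall>\<alpha>\<in>x. \<alpha> \<le> \<beta>)"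

definition birthday :: "ordinal set \<Rightarrow> ordinal" where
  "birthday x = (GREATEST \<alpha>. \<alpha> \<in> x)"

definition opposite :: "ordinal set \<Rightarrow> ordinal set" where
  "opposite x = {\<alpha>. \<alpha> < birthday x \<and> \<alpha> \<notin> x} \<union> {birthday x}"

definition short_numbers :: "ordinal set set" where
  "short_numbers = {x. x \<noteq> {} \<and> finite x \<and> x \<subseteq> range ord_of_nat}"

definition long_conway_reals :: "ordinal set set" where
  "long_conway_reals = {x. conway_number x \<and>
     (\<exists>X. X \<subseteq> range ord_of_nat \<and> infinite X \<and> infinite (range ord_of_nat - X) \<and>
          x = X \<union> {omega})}"

definition conway_reals :: "ordinal set set" where
  "conway_reals = short_numbers \<union> long_conway_reals"

definition conway_ord :: "ordinal \<Rightarrow> ordinal set" where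
  "conway_ord \<alpha> = {\<beta>. \<beta> \<le> \<alpha>}"

definition finite_conway_ordinals :: "ordinal set set" where
  "finite_conway_ordinals = conway_ord ` {\<alpha>. \<alpha> < omega}"

definition conway_ord_add :: "ordinal set \<Rightarrow> ordinal set \<Rightarrow> ordinal set" where
  "conway_ord_add x y = conway_ord (ord_add (inv conway_ord x) (inv conway_ord y))"

definition conway_ord_mult :: "ordinal set \<Rightarrow> ordinal set \<Rightarrow> ordinal set" where
  "conway_ord_mult x y = conway_ord (ord_mult (inv conway_ord x) (inv conway_ord y))"

text \<open>The value of a Conway real not containing \<open>0\<close>; here \<open>X\<close> is \<open>x \<inter> \<nat>\<close> and \<open>k\<close> is \<open>min x\<close>.\<close>
definition neg_real_of_conway :: "ordinal set \<Rightarrow> real" where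
  "neg_real_of_conway x =
     (let X = {m. ord_of_nat m \<in> x}; k = (LEAST m. m \<in> X)
      in - real k + (\<Sum>\<^sub>\<infinity>m\<in>{m \<in> X. m > k}. (1 / 2) ^ (m - k)))"

text \<open>
  The equation \<open>r x = - r (opposite x)\<close> for \<open>0 \<in> x\<close> is self-referential only for \<open>x = {0}\<close>,
  which is its own opposite; it forces \<open>r {0} = 0\<close>.  In all other cases \<open>0 \<notin> opposite x\<close>.
\<close>
definition real_of_conway :: "ordinal set \<Rightarrow> real" where
  "real_of_conway x =
     (if ord_of_nat 0 \<notin> x then neg_real_of_conway x
      else if x = {ord_of_nat 0} then 0
      else - neg_real_of_conway (opposite x))"

text \<open>
  The expansion \<open>r = - r\<^sub>0 + (\<Sum>k\<ge>1. a\<^sub>k 2\<^bsup>-k\<^esup>)\<close>.  Digits are indexed from \<open>1\<close>; the unused \<open>a 0\<close> is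
  fixed to be \<open>0\<close> so that the pair \<open>(r\<^sub>0, a)\<close> is determined by \<open>r\<close>.
\<close>
definition binary_expansion :: "real \<Rightarrow> nat \<Rightarrow> (nat \<Rightarrow> nat) \<Rightarrow> bool" where
  "binary_expansion r r0 a \<longleftrightarrow>
     r0 \<ge> 1 \<and> a 0 = 0 \<and> (\<forall>k. a k \<in> {0, 1}) \<and>
     (\<lambda>k. real (a k) * (1 / 2) ^ k) sums (r + real r0) \<and>
     \<not> (\<exists>N. \<forall>k\<ge>N. a k = 1)"

definition conway_of_expansion :: "nat \<Rightarrow> (nat \<Rightarrow> nat) \<Rightarrow> ordinal set" where
  "conway_of_expansion r0 a =
     {ord_of_nat r0} \<union> {ord_of_nat (r0 + k) | k. k \<ge> 1 \<and> a k = 1} \<union>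
     (if finite {k. k \<ge> 1 \<and> a k = 1} then {} else {omega})"

definition neg_conway_of_real :: "real \<Rightarrow> ordinal set" where
  "neg_conway_of_real r =
     (THE x. \<exists>r0 a. binary_expansion r r0 a \<and> x = conway_of_expansion r0 a)"

definition conway_of_real :: "real \<Rightarrow> ordinal set" where
  "conway_of_real r =
     (if r < 0 then neg_conway_of_real r
      else if r = 0 then {ord_of_nat 0}
      else opposite (neg_conway_of_real (- r)))"

definition dyadic_rationals :: "real set" where
  "dyadic_rationals = {real_of_int a / 2 ^ k | a k. True}"

end

theory Submission
  imports Defs "HOL-Library.Countable_Set_Type"
begin

text \<open>
  Everything is driven by the numbers without \<open>0\<close>.  Listing such a Conway real \<open>x\<close> as its least
  element \<open>r\<^sub>0\<close> together with the digit sequence \<open>a\<close>, where \<open>a\<^sub>k = 1\<close> iff \<open>r\<^sub>0 + k \<in> x\<close>, turns \<open>x\<close> into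
  the data of a binary expansion of a negative real.  The two conditions match: a finite set gives
  a finite expansion, and co-infinity of the natural part of a long real says exactly that the
  digits are not eventually \<open>1\<close>; the ordinal \<open>\<omega>\<close> merely records that the expansion is infinite
  (\<open>conway_of_expansion_conway_real\<close>, \<open>conway_real_is_expansion\<close>).  The sum defining \<open>r(x)\<close> is the
  value of this expansion (\<open>neg_real_of_conway_of_expansion\<close>).  So on numbers without \<open>0\<close> the
  correspondence is the existence and uniqueness of binary expansions of negative reals.

  For these the key fact is that the integer formed by the first \<open>n\<close> digits of the fractional part
  \<open>s = r + r\<^sub>0\<close> is \<open>\<lfloor>2\<^sup>n s\<rfloor>\<close>, because the remaining digits, not being all \<open>1\<close>, contribute less than one
  unit (\<open>floor_binary_expansion\<close>).  It yields uniqueness, and also that dyadic numbers are those with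
  finitely many digits \<open>1\<close>, since \<open>2\<^sup>n s\<close> is eventually an even integer in the dyadic case.

  The opposite is an involution on Conway reals which, apart from the fixed point \<open>{0}\<close>, exchanges
  the numbers with \<open>0\<close> and those without; it matches \<open>r \<mapsto> -r\<close> and carries the result to positive
  reals.  Since \<open>n + 1 = {0,\<dots>,n}\<close> is the opposite of \<open>{n}\<close>, finite Conway ordinals have the values
  \<open>0, 1, 2, \<dots>\<close>, and ordinal arithmetic below \<open>\<omega>\<close> is arithmetic of natural numbers.
\<close>

section \<open>The ordinals below \<open>\<omega>\<close>\<close>

unbundle cardinal_syntax

lemma countable_initial_segment: "countable {\<beta>::ordinal. \<beta> < \<alpha>}"
proof -
  let ?r = "cardSuc natLeq"
  have "|underS ?r (Rep_ordinal \<alpha>)| <o ?r"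
    using card_of_underS[OF cardSuc_Card_order[OF natLeq_Card_order] Rep_ordinal] .
  then have "|underS ?r (Rep_ordinal \<alpha>)| \<le>o natLeq"
    using cardSuc_ordLeq_ordLess[OF natLeq_Card_order card_of_Card_order] by blast
  then have "countable (underS ?r (Rep_ordinal \<alpha>))"
    by (simp add: countable_card_le_natLeq)
  moreover have "Rep_ordinal ` {\<beta>. \<beta> < \<alpha>} \<subseteq> underS ?r (Rep_ordinal \<alpha>)"
    by (auto simp: underS_def less_ordinal_def less_eq_ordinal_def Rep_ordinal_inject)
  ultimately show ?thesis
    by (meson Rep_ordinal_inject countable_image_inj_on countable_subset inj_onI)
qed

lemma uncountable_ordinals: "uncountable (UNIV :: ordinal set)"
proof
  assume "countable (UNIV :: ordinal set)"
  then have "countable (Field (cardSuc natLeq))"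
    by (metis countable_image type_definition.Rep_range type_definition_ordinal)
  then have "|Field (cardSuc natLeq)| \<le>o natLeq"
    by (simp add: countable_card_le_natLeq)
  moreover have "|Field (cardSuc natLeq)| =o cardSuc natLeq"
    by (intro card_of_Field_ordIso cardSuc_Card_order natLeq_Card_order)
  ultimately have "cardSuc natLeq \<le>o natLeq"
    using ordIso_ordLeq_trans ordIso_symmetric by blast
  then show False
    using cardSuc_greater[OF natLeq_Card_order] not_ordLess_ordLeq by blast
qed

text \<open>
  An unbounded countable set would exhibit the type as a countable union of countable initial
  segments.  This is what makes successors and \<open>\<omega>\<close> exist, so that the \<open>LEAST\<close> in their
  definitions has a witness.
\<close>

lemma countable_ordinals_bounded:
  assumes "countable (A :: ordinal set)"
  shows "\<exists>\<beta>. \<forall>\<alpha>\<in>A. \<alpha> < \<beta>"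
proof (rule ccontr)
  assume "\<not> ?thesis"
  then have "(UNIV :: ordinal set) = (\<Union>\<alpha>\<in>A. insert \<alpha> {\<beta>. \<beta> < \<alpha>})"
    by (auto simp: not_less) (metis order_le_less)
  moreover have "countable (\<Union>\<alpha>\<in>A. insert \<alpha> {\<beta>. \<beta> < \<alpha>})"
    using assms by (intro countable_UN countable_insert countable_initial_segment) auto
  ultimately show False
    using uncountable_ordinals by simp
qed

unbundle no cardinal_syntax

lemma ord_of_nat_0_le: "ord_of_nat 0 \<le> \<alpha>"
  by (simp add: Least_le)

lemma ord_of_nat_less_Suc: "ord_of_nat n < ord_of_nat (Suc n)"
  using countable_ordinals_bounded[of "{ord_of_nat n}"] by (auto intro: LeastI)

lemma ord_of_nat_Suc_le: "ord_of_nat n < \<alpha> \<Longrightarrow> ord_of_nat (Suc n) \<le> \<alpha>"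
  by (simp add: Least_le)

lemma strict_mono_ord_of_nat: "strict_mono ord_of_nat"
  by (rule strict_mono_Suc_iff[THEN iffD2]) (use ord_of_nat_less_Suc in blast)

lemmas ord_of_nat_less_iff [simp] = strict_mono_less[OF strict_mono_ord_of_nat]
lemmas ord_of_nat_le_iff [simp] = strict_mono_less_eq[OF strict_mono_ord_of_nat]
lemmas ord_of_nat_eq_iff [simp] = strict_mono_eq[OF strict_mono_ord_of_nat]

declare ord_of_nat.simps [simp del]

lemma ord_of_nat_less_omega [simp]: "ord_of_nat n < omega"
proof -
  have "\<exists>\<alpha>. \<forall>n. ord_of_nat n < \<alpha>"
    using countable_ordinals_bounded[of "range ord_of_nat"] by auto
  then have "\<forall>n. ord_of_nat n < omega"
    unfolding omega_def by (rule LeastI_ex)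
  then show ?thesis ..
qed

lemma ord_of_nat_neq_omega [simp]: "ord_of_nat n \<noteq> omega" "omega \<noteq> ord_of_nat n"
  using ord_of_nat_less_omega[of n] by (metis less_irrefl)+

lemma ord_of_nat_le_omega [simp]: "ord_of_nat n \<le> omega"
  by (rule less_imp_le) simp

text \<open>
  There are no gaps: everything strictly above \<open>n\<close> is at least \<open>n + 1\<close>.
\<close>

lemma less_ord_of_nat_imp: "\<alpha> < ord_of_nat n \<Longrightarrow> \<exists>m<n. \<alpha> = ord_of_nat m"
proof (induction n)
  case 0
  then show ?case using ord_of_nat_0_le[of \<alpha>] by simp
next
  case (Suc n)
  then show ?case
    by (metis less_Suc_eq linorder_less_linear not_less ord_of_nat_Suc_le)
qed

lemma lessThan_ord_of_nat: "{\<alpha>. \<alpha> < ord_of_nat n} = ord_of_nat ` {..<n}"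
  using less_ord_of_nat_imp by force

lemma lessThan_omega: "{\<alpha>. \<alpha> < omega} = range ord_of_nat"
proof -
  have "\<exists>n. \<alpha> = ord_of_nat n" if "\<alpha> < omega" for \<alpha>
  proof -
    have "\<not> (\<forall>n. ord_of_nat n < \<alpha>)"
      using that not_less_Least unfolding omega_def by blast
    then show ?thesis
      using less_ord_of_nat_imp by (metis linorder_neqE)
  qed
  then show ?thesis by auto
qed

section \<open>Finite ordinal arithmetic\<close>

lemma ord_add_rec: "ord_add \<alpha> \<beta> = (LEAST \<delta>. \<alpha> \<le> \<delta> \<and> (\<forall>\<gamma><\<beta>. ord_add \<alpha> \<gamma> < \<delta>))"
  unfolding ord_add_def
  by (subst wfrec[OF wf]) (rule arg_cong[where f = Least], auto simp: fun_eq_iff cut_apply)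

lemma ord_mult_rec: "ord_mult \<alpha> \<beta> = (LEAST \<delta>. \<forall>\<gamma><\<beta>. ord_add (ord_mult \<alpha> \<gamma>) \<alpha> \<le> \<delta>)"
  unfolding ord_mult_def
  by (subst wfrec[OF wf]) (rule arg_cong[where f = Least], auto simp: fun_eq_iff cut_apply)

lemma all_less_ord_of_nat: "(\<forall>\<gamma><ord_of_nat n. P \<gamma>) \<longleftrightarrow> (\<forall>m<n. P (ord_of_nat m))"
  using less_ord_of_nat_imp by force

lemma ord_add_of_nat: "ord_add (ord_of_nat m) (ord_of_nat n) = ord_of_nat (m + n)"
proof (induction n rule: less_induct)
  case (less n)
  have "ord_add (ord_of_nat m) (ord_of_nat n)
      = (LEAST \<delta>. ord_of_nat m \<le> \<delta> \<and> (\<forall>k<n. ord_of_nat (m + k) < \<delta>))"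
    by (subst ord_add_rec) (simp add: all_less_ord_of_nat less.IH cong: conj_cong)
  also have "\<dots> = ord_of_nat (m + n)"
  proof (rule Least_equality)
    fix \<delta> assume \<delta>: "ord_of_nat m \<le> \<delta> \<and> (\<forall>k<n. ord_of_nat (m + k) < \<delta>)"
    show "ord_of_nat (m + n) \<le> \<delta>"
      by (cases n) (use \<delta> ord_of_nat_Suc_le in auto)
  qed auto
  finally show ?case .
qed

lemma ord_mult_of_nat: "ord_mult (ord_of_nat m) (ord_of_nat n) = ord_of_nat (m * n)"
proof (induction n rule: less_induct)
  case (less n)
  have "ord_mult (ord_of_nat m) (ord_of_nat n) = (LEAST \<delta>. \<forall>k<n. ord_of_nat (m * k + m) \<le> \<delta>)"
    by (subst ord_mult_rec) (simp add: all_less_ord_of_nat less.IH ord_add_of_nat)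
  also have "\<dots> = ord_of_nat (m * n)"
  proof (rule Least_equality)
    show "\<forall>k<n. ord_of_nat (m * k + m) \<le> ord_of_nat (m * n)"
      by (metis Suc_leI add.commute mult_Suc_right mult_le_mono2 ord_of_nat_le_iff)
  next
    fix \<delta> assume \<delta>: "\<forall>k<n. ord_of_nat (m * k + m) \<le> \<delta>"
    show "ord_of_nat (m * n) \<le> \<delta>"
      by (cases n) (use \<delta> ord_of_nat_0_le in \<open>auto simp: add.commute\<close>)
  qed
  finally show ?case .
qed

lemma inj_conway_ord: "inj conway_ord"
  unfolding conway_ord_def inj_def by (metis antisym mem_Collect_eq order_refl)

lemma conway_ord_add: "conway_ord_add (conway_ord \<alpha>) (conway_ord \<beta>) = conway_ord (ord_add \<alpha> \<beta>)"
  by (simp add: conway_ord_add_def inj_conway_ord)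

lemma conway_ord_mult: "conway_ord_mult (conway_ord \<alpha>) (conway_ord \<beta>) = conway_ord (ord_mult \<alpha> \<beta>)"
  by (simp add: conway_ord_mult_def inj_conway_ord)

lemma finite_conway_ordinals_eq: "finite_conway_ordinals = range (\<lambda>n. conway_ord (ord_of_nat n))"
  unfolding finite_conway_ordinals_def lessThan_omega by auto

section \<open>The opposite of a number\<close>

lemma birthday_eqI:
  assumes "\<beta> \<in> x" "\<And>\<alpha>. \<alpha> \<in> x \<Longrightarrow> \<alpha> \<le> \<beta>"
  shows "birthday x = \<beta>"
  unfolding birthday_def using assms by (rule Greatest_equality)

lemma birthday_opposite: "birthday (opposite x) = birthday x"
  by (rule birthday_eqI) (auto simp: opposite_def)

text \<open>
  The opposite keeps the birthday and complements the set below it.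
\<close>

lemma opposite_opposite:
  assumes "conway_number x"
  shows "opposite (opposite x) = x"
proof -
  obtain \<beta> where \<beta>: "\<beta> \<in> x" "\<forall>\<alpha>\<in>x. \<alpha> \<le> \<beta>"
    using assms by (auto simp: conway_number_def)
  then have "birthday x = \<beta>"
    by (intro birthday_eqI) auto
  then show ?thesis
    using \<beta> by (auto simp: opposite_def[of "opposite x"] birthday_opposite)
      (auto simp: opposite_def order.strict_iff_order)
qed

text \<open>
  Only for \<open>{0}\<close> is the birthday \<open>0\<close>; otherwise \<open>0\<close> lies strictly below the birthday, where the
  opposite is the complement.
\<close>

lemma zero_in_opposite_iff:
  assumes "conway_number x" "x \<noteq> {ord_of_nat 0}"
  shows "ord_of_nat 0 \<in> opposite x \<longleftrightarrow> ord_of_nat 0 \<notin> x"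
proof -
  obtain \<beta> where \<beta>: "\<beta> \<in> x" "\<forall>\<alpha>\<in>x. \<alpha> \<le> \<beta>"
    using assms by (auto simp: conway_number_def)
  then have b: "birthday x = \<beta>"
    by (intro birthday_eqI) auto
  have "\<beta> \<noteq> ord_of_nat 0"
    using \<beta> assms(2) ord_of_nat_0_le by (auto simp: set_eq_iff) (metis order_antisym)+
  then have "ord_of_nat 0 < \<beta>"
    using ord_of_nat_0_le[of \<beta>] by auto
  then show ?thesis
    by (auto simp: opposite_def b)
qed

lemma short_number_conway_number:
  assumes "x \<in> short_numbers"
  obtains n where "birthday x = ord_of_nat n" "ord_of_nat n \<in> x" "\<forall>\<alpha>\<in>x. \<alpha> \<le> ord_of_nat n"
proof -
  have "finite x" "x \<noteq> {}" "x \<subseteq> range ord_of_nat"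
    using assms by (auto simp: short_numbers_def)
  then have "Max x \<in> x" "\<forall>\<alpha>\<in>x. \<alpha> \<le> Max x" "Max x \<in> range ord_of_nat"
    by auto (use Max_in[OF \<open>finite x\<close> \<open>x \<noteq> {}\<close>] in blast)
  moreover then have "birthday x = Max x"
    by (intro birthday_eqI) auto
  ultimately show ?thesis
    using that by auto
qed

lemma conway_real_is_number: "x \<in> conway_reals \<Longrightarrow> conway_number x"
  unfolding conway_reals_def
  using short_number_conway_number[of x] by (auto simp: long_conway_reals_def conway_number_def)

lemma opposite_short: 
  assumes "x \<in> short_numbers"
  shows "opposite x \<in> short_numbers"
proof -
  obtain n where n: "birthday x = ord_of_nat n"
    using assms short_number_conway_number by blast
  have "opposite x \<subseteq> insert (ord_of_nat n) {\<alpha>. \<alpha> < ord_of_nat n}"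
    by (auto simp: opposite_def n)
  then have sub: "opposite x \<subseteq> ord_of_nat ` {..n}"
    unfolding lessThan_ord_of_nat by force
  then have "finite (opposite x)"
    using finite_surj by blast
  with sub show ?thesis
    by (auto simp: short_numbers_def opposite_def)
qed

text \<open>
  The natural part of a long real is complemented in \<open>\<nat>\<close>; being infinite and co-infinite is
  symmetric under this.
\<close>

lemma opposite_long: 
  assumes "X \<subseteq> range ord_of_nat"
  shows "opposite (X \<union> {omega}) = (range ord_of_nat - X) \<union> {omega}"
proof -
  have "birthday (X \<union> {omega}) = omega"
    using assms by (intro birthday_eqI) auto
  then have "opposite (X \<union> {omega}) = ({\<alpha>. \<alpha> < omega} - X) \<union> {omega}"
    by (auto simp: opposite_def)
  then show ?thesis by (simp add: lessThan_omega)
qed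

lemma opposite_conway_real:
  assumes "x \<in> conway_reals"
  shows "opposite x \<in> conway_reals"
proof (cases "x \<in> short_numbers")
  case True
  then show ?thesis by (simp add: conway_reals_def opposite_short)
next
  case False
  with assms obtain X where X: "X \<subseteq> range ord_of_nat" "infinite X"
    "infinite (range ord_of_nat - X)" "x = X \<union> {omega}"
    by (auto simp: conway_reals_def long_conway_reals_def)
  let ?Y = "range ord_of_nat - X"
  have "opposite x = ?Y \<union> {omega}"
    using X opposite_long by simp
  moreover have "range ord_of_nat - ?Y = X"
    using X by auto
  moreover have "conway_number (?Y \<union> {omega})"
    by (auto simp: conway_number_def intro!: bexI[of _ omega])
  ultimately have "opposite x \<in> long_conway_reals"
    unfolding long_conway_reals_def using X by (auto intro!: exI[of _ ?Y])
  then show ?thesis by (simp add: conway_reals_def)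
qed

text \<open>
  This is why the value \<open>-n\<close> of \<open>{n}\<close> determines the value of the \<open>n\<close>-th Conway ordinal.
\<close>

lemma opposite_singleton: "opposite {ord_of_nat n} = conway_ord (ord_of_nat n)"
proof -
  have "birthday {ord_of_nat n} = ord_of_nat n"
    by (rule birthday_eqI) auto
  then show ?thesis
    by (auto simp: opposite_def conway_ord_def)
qed

section \<open>Binary expansions\<close>

definition binary_digits :: "(nat \<Rightarrow> nat) \<Rightarrow> bool" where
  "binary_digits a \<longleftrightarrow> a 0 = 0 \<and> (\<forall>k. a k \<in> {0, 1}) \<and> \<not> (\<exists>N. \<forall>k\<ge>N. a k = 1)"

lemma binary_expansion_iff:
  "binary_expansion r r0 a \<longleftrightarrow>
     r0 \<ge> 1 \<and> binary_digits a \<and> (\<lambda>k. real (a k) * (1 / 2) ^ k) sums (r + real r0)"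
  unfolding binary_expansion_def binary_digits_def by blast

lemma binary_digits_le_1: "binary_digits a \<Longrightarrow> a k \<le> 1"
  unfolding binary_digits_def by (metis insertE le_eq_less_or_eq less_one singletonD zero_less_one)

lemma binary_digits_summable:
  assumes "binary_digits a"
  shows "summable (\<lambda>k. real (a k) * (1 / 2) ^ k)"
proof (rule summable_comparison_test')
  show "summable (\<lambda>k. (1 / 2 :: real) ^ k)"
    by (simp add: summable_geometric)
  show "norm (real (a k) * (1 / 2) ^ k) \<le> (1 / 2) ^ k" for k
    using binary_digits_le_1[OF assms, of k] by (simp add: field_simps)
qed

text \<open>
  The geometric series with all digits \<open>1\<close> has sum \<open>1\<close>, and the digit at \<open>i\<close> leaves out a positive
  term of it.
\<close>

lemma binary_fraction_less_1:
  fixes c :: "nat \<Rightarrow> nat"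
  assumes c: "\<And>k. c k \<le> 1" and zero: "c i = 0"
    and sums: "(\<lambda>k. real (c k) * (1 / 2) ^ Suc k) sums u"
  shows "0 \<le> u" "u < 1"
proof -
  show "0 \<le> u"
    by (rule sums_le[OF _ sums_zero sums]) simp
  have d: "(\<lambda>k. (1 - real (c k)) * (1 / 2) ^ Suc k) sums (1 - u)"
    using sums_diff[OF power_half_series sums] by (simp only: left_diff_distrib mult_1)
  have "0 < (\<Sum>k. (1 - real (c k)) * (1 / 2) ^ Suc k)"
  proof (rule suminf_pos2)
    show "summable (\<lambda>k. (1 - real (c k)) * (1 / 2) ^ Suc k)"
      using d by (rule sums_summable)
    show "0 \<le> (1 - real (c k)) * (1 / 2) ^ Suc k" for k
      using c[of k] by simp
    show "0 < (1 - real (c i)) * (1 / 2) ^ Suc i"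
      using zero by simp
  qed
  then show "u < 1"
    using sums_unique[OF d] by simp
qed

text \<open>
  Multiplication by \<open>2\<^sup>n\<close> turns the first digits into an integer.  The rest is again a binary fraction,
  and it lies in \<open>[0, 1)\<close> because some later digit is \<open>0\<close>.
\<close>

lemma floor_binary_expansion:
  assumes a: "binary_digits a" and s: "(\<lambda>k. real (a k) * (1 / 2) ^ k) sums s"
  shows "\<lfloor>2 ^ n * s\<rfloor> = int (\<Sum>k\<le>n. a k * 2 ^ (n - k))"
proof -
  let ?f = "\<lambda>k. real (a k) * (1 / 2) ^ k"
  define u where "u = 2 ^ n * (s - (\<Sum>k<Suc n. ?f k))"
  have "(\<lambda>k. ?f (k + Suc n)) sums (s - (\<Sum>k<Suc n. ?f k))"
    by (rule sums_split_initial_segment[OF s])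
  then have "(\<lambda>k. 2 ^ n * ?f (k + Suc n)) sums u"
    unfolding u_def by (rule sums_mult)
  moreover have "2 ^ n * ?f (k + Suc n) = real (a (k + Suc n)) * (1 / 2) ^ Suc k" for k
    by (simp add: power_add field_simps)
  ultimately have "(\<lambda>k. real (a (k + Suc n)) * (1 / 2) ^ Suc k) sums u"
    by (simp only:)
  moreover obtain i where "a (i + Suc n) = 0"
  proof -
    obtain k where "k \<ge> Suc n" "a k \<noteq> 1" "a k \<in> {0, 1}"
      using a unfolding binary_digits_def by blast
    then show ?thesis using that[of "k - Suc n"] by simp
  qed
  ultimately have u: "0 \<le> u" "u < 1"
    using binary_fraction_less_1[of "\<lambda>k. a (k + Suc n)"] binary_digits_le_1[OF a] by blast+
  have "2 ^ n * (\<Sum>k<Suc n. ?f k) = (\<Sum>k\<le>n. real (a k) * 2 ^ (n - k))"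
    unfolding lessThan_Suc_atMost sum_distrib_left
    by (intro sum.cong) (auto simp: power_diff power_divide)
  then have "2 ^ n * s = real_of_int (int (\<Sum>k\<le>n. a k * 2 ^ (n - k))) + u"
    by (simp add: u_def algebra_simps)
  then show ?thesis
    using u by (intro floor_unique) auto
qed

lemma binary_digit_eq_floor:
  assumes "binary_digits a" "(\<lambda>k. real (a k) * (1 / 2) ^ k) sums s"
  shows "int (a (Suc n)) = \<lfloor>2 ^ Suc n * s\<rfloor> - 2 * \<lfloor>2 ^ n * s\<rfloor>"
proof -
  have "(\<Sum>k\<le>n. a k * 2 ^ (Suc n - k)) = 2 * (\<Sum>k\<le>n. a k * 2 ^ (n - k))"
    unfolding sum_distrib_left by (intro sum.cong) (auto simp: Suc_diff_le)
  then show ?thesis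
    unfolding floor_binary_expansion[OF assms] by simp
qed

text \<open>
  The case \<open>n = 0\<close> of the floor formula determines \<open>r\<^sub>0\<close>, consecutive floors determine the digits.
\<close>

lemma binary_expansion_unique:
  assumes "binary_expansion r r0 a" "binary_expansion r q0 b"
  shows "r0 = q0" "a = b"
proof -
  have A: "binary_digits a" "(\<lambda>k. real (a k) * (1 / 2) ^ k) sums (r + real r0)"
    and B: "binary_digits b" "(\<lambda>k. real (b k) * (1 / 2) ^ k) sums (r + real q0)"
    using assms by (auto simp: binary_expansion_iff)
  have "a 0 = 0" "b 0 = 0"
    using A B by (auto simp: binary_digits_def)
  then have "\<lfloor>r + real r0\<rfloor> = 0" "\<lfloor>r + real q0\<rfloor> = 0"
    using floor_binary_expansion[OF A, of 0] floor_binary_expansion[OF B, of 0] by auto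
  then show eq: "r0 = q0"
    by linarith
  show "a = b"
  proof
    fix k show "a k = b k"
    proof (cases k)
      case (Suc n)
      then show ?thesis
        using binary_digit_eq_floor[OF A, of n] binary_digit_eq_floor[OF B, of n] eq by simp
    qed (use \<open>a 0 = 0\<close> \<open>b 0 = 0\<close> in simp)
  qed
qed

text \<open>
  The digit \<open>a\<^sub>k\<close> is the parity of \<open>\<lfloor>2\<^sup>k s\<rfloor>\<close>, as the floor formula dictates.
\<close>

lemma ex_binary_digits:
  fixes s :: real
  assumes "0 \<le> s" "s < 1"
  obtains a where "binary_digits a" "(\<lambda>k. real (a k) * (1 / 2) ^ k) sums s"
proof
  define F where "F n = \<lfloor>2 ^ n * s\<rfloor>" for n :: nat
  define a where "a k = nat (F k mod 2)" for k
  have F0: "F 0 = 0"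
    using assms by (simp add: F_def floor_eq_iff)
  have a01: "a k = 0 \<or> a k = 1" for k
    by (auto simp: a_def)
  have F_half: "F (Suc n) div 2 = F n" for n
    unfolding F_def using floor_divide_real_eq_div[of 2 "2 ^ Suc n * s"] by simp
  have F_Suc: "F (Suc n) = 2 * F n + int (a (Suc n))" for n
    using div_mult_mod_eq[of "F (Suc n)" 2] F_half[of n] by (simp add: a_def)
  have bounds: "real_of_int (F n) \<le> 2 ^ n * s" "2 ^ n * s < real_of_int (F n) + 1" for n
    by (simp_all add: F_def)
  have partial: "(\<Sum>k<Suc n. real (a k) * (1 / 2) ^ k) = real_of_int (F n) / 2 ^ n" for n
  proof (induction n)
    case 0
    then show ?case using F0 by (simp add: a_def)
  next
    case (Suc n)
    then show ?case by (simp add: F_Suc field_simps)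
  qed
  have "(\<lambda>n. real_of_int (F n) / 2 ^ n) \<longlonglongrightarrow> s"
  proof (rule LIMSEQ_I)
    fix e :: real assume "0 < e"
    then obtain N where N: "(1 / 2 :: real) ^ N < e"
      using real_arch_pow_inv[of e "1 / 2"] by auto
    have "norm (real_of_int (F n) / 2 ^ n - s) < e" if "n \<ge> N" for n
    proof -
      have "\<bar>real_of_int (F n) / 2 ^ n - s\<bar> = \<bar>real_of_int (F n) - 2 ^ n * s\<bar> / 2 ^ n"
        by (subst abs_div_pos) (simp_all add: diff_divide_distrib)
      also have "\<dots> \<le> 1 / 2 ^ n"
        using bounds[of n] by (intro divide_right_mono) auto
      also have "\<dots> \<le> (1 / 2) ^ N"
        using that by (simp add: power_divide field_simps)
      finally show ?thesis using N by simp
    qed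
    then show "\<exists>N. \<forall>n\<ge>N. norm (real_of_int (F n) / 2 ^ n - s) < e" by blast
  qed
  then have "(\<lambda>n. \<Sum>k<Suc n. real (a k) * (1 / 2) ^ k) \<longlonglongrightarrow> s"
    by (simp only: partial)
  then show "(\<lambda>k. real (a k) * (1 / 2) ^ k) sums s"
    unfolding sums_def by (rule filterlim_sequentially_Suc[THEN iffD1])
  have "\<not> (\<forall>k\<ge>N. a k = 1)" for N
  proof
    assume ones: "\<forall>k\<ge>N. a k = 1"
    \<comment> \<open>\<open>t n\<close> is the distance from \<open>2\<^sup>n s\<close> up to the next integer above it.  A digit \<open>1\<close> doubles it, so it
      cannot stay bounded by \<open>1\<close> under an unbroken run of ones.\<close>
    define t where "t n = real_of_int (F n) + 1 - 2 ^ n * s" for n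
    have double: "t (N + j) = 2 ^ j * t N" for j
    proof (induction j)
      case (Suc j)
      have "t (Suc (N + j)) = 2 * t (N + j)"
        using ones by (simp add: t_def F_Suc)
      with Suc show ?case by simp
    qed simp
    have "0 < t N"
      using bounds[of N] by (simp add: t_def)
    then obtain j where "1 / t N < 2 ^ j"
      using real_arch_pow[of 2 "1 / t N"] by auto
    then have "1 < t (N + j)"
      using \<open>0 < t N\<close> by (simp add: double field_simps)
    moreover have "t (N + j) \<le> 1"
      using bounds[of "N + j"] by (simp add: t_def)
    ultimately show False by simp
  qed
  then show "binary_digits a"
    using a01 F0 by (auto simp: binary_digits_def) (simp add: a_def)
qed

lemma ex_binary_expansion:
  assumes "r < 0"
  obtains r0 a where "binary_expansion r r0 a"
proof -
  define r0 where "r0 = nat (- \<lfloor>r\<rfloor>)"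
  have r0: "r0 \<ge> 1" "real r0 = - real_of_int \<lfloor>r\<rfloor>"
    using assms unfolding r0_def by linarith+
  have "0 \<le> r + real r0" "r + real r0 < 1"
    unfolding r0 by linarith+
  then obtain a where "binary_digits a" "(\<lambda>k. real (a k) * (1 / 2) ^ k) sums (r + real r0)"
    by (rule ex_binary_digits)
  with r0 show ?thesis
    by (intro that[of r0 a]) (auto simp: binary_expansion_iff)
qed

lemma binary_expansion_negative:
  assumes "binary_expansion r r0 a"
  shows "r < 0"
proof -
  have a: "binary_digits a" "(\<lambda>k. real (a k) * (1 / 2) ^ k) sums (r + real r0)" and "r0 \<ge> 1"
    using assms by (auto simp: binary_expansion_iff)
  moreover have "a 0 = 0"
    using a(1) by (simp add: binary_digits_def)
  ultimately have "\<lfloor>r + real r0\<rfloor> = 0"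
    using floor_binary_expansion[OF a, of 0] by simp
  with \<open>r0 \<ge> 1\<close> show ?thesis by linarith
qed

lemma dyadic_rationals_minus: "r \<in> dyadic_rationals \<Longrightarrow> - r \<in> dyadic_rationals"
  unfolding dyadic_rationals_def by clarsimp (metis minus_divide_left of_int_minus)

text \<open>
  If \<open>r\<close> has denominator \<open>2\<^sup>K\<close>, then \<open>2\<^sup>n (r + r\<^sub>0)\<close> is an integer for \<open>n \<ge> K\<close> and is doubled from one \<open>n\<close>
  to the next, so the digits after position \<open>K\<close> vanish.  The converse puts a finite sum over a
  common denominator.
\<close>

lemma dyadic_iff_finite_expansion:
  assumes "binary_expansion r r0 a"
  shows "r \<in> dyadic_rationals \<longleftrightarrow> finite {k. k \<ge> 1 \<and> a k = 1}"
proof -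
  have a: "binary_digits a" "(\<lambda>k. real (a k) * (1 / 2) ^ k) sums (r + real r0)"
    using assms by (auto simp: binary_expansion_iff)
  show ?thesis
  proof
    assume "r \<in> dyadic_rationals"
    then obtain c :: int and K where c: "r = c / 2 ^ K"
      by (auto simp: dyadic_rationals_def)
    have fl: "\<lfloor>2 ^ (K + j) * (r + real r0)\<rfloor> = 2 ^ j * (c + int r0 * 2 ^ K)" for j
    proof -
      have "2 ^ (K + j) * (r + real r0) = real_of_int (2 ^ j * (c + int r0 * 2 ^ K))"
        by (simp add: c power_add field_simps)
      then show ?thesis by (metis floor_of_int)
    qed
    have "a (Suc (K + j)) = 0" for j
      using binary_digit_eq_floor[OF a, of "K + j"] fl[of j] fl[of "Suc j"] by simp
    then have "k \<le> K" if "a k = 1" for k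
      using that by (metis add_Suc_right less_imp_Suc_add not_le zero_neq_one)
    then have "{k. k \<ge> 1 \<and> a k = 1} \<subseteq> {..K}"
      by auto
    then show "finite {k. k \<ge> 1 \<and> a k = 1}"
      using finite_subset by blast
  next
    assume "finite {k. k \<ge> 1 \<and> a k = 1}"
    then obtain n where n: "{k. k \<ge> 1 \<and> a k = 1} \<subseteq> {..n}"
      using finite_nat_iff_bounded_le by blast
    have "a k = 0" if "k \<notin> {..n}" for k
    proof -
      have "a k \<noteq> 1" using that subsetD[OF n, of k] by auto
      then show ?thesis using a(1) by (auto simp: binary_digits_def)
    qed
    then have "(\<lambda>k. real (a k) * (1 / 2) ^ k) sums (\<Sum>k\<le>n. real (a k) * (1 / 2) ^ k)"
      by (intro sums_finite) auto
    then have "r + real r0 = (\<Sum>k\<le>n. real (a k) * (1 / 2) ^ k)"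
      using a(2) sums_unique2 by blast
    also have "\<dots> = (\<Sum>k\<le>n. real (a k * 2 ^ (n - k)) / 2 ^ n)"
      by (intro sum.cong) (auto simp: power_divide field_simps simp flip: power_add)
    finally have "r = real_of_int (int (\<Sum>k\<le>n. a k * 2 ^ (n - k)) - int r0 * 2 ^ n) / 2 ^ n"
      by (simp add: sum_divide_distrib diff_divide_distrib)
    then show "r \<in> dyadic_rationals"
      unfolding dyadic_rationals_def by blast
  qed
qed

section \<open>Conway reals without \<open>0\<close> as binary expansions\<close>

lemma ord_of_nat_in_conway_of_expansion:
  "ord_of_nat m \<in> conway_of_expansion r0 a \<longleftrightarrow> m = r0 \<or> m > r0 \<and> a (m - r0) = 1"
proof
  assume "m = r0 \<or> m > r0 \<and> a (m - r0) = 1"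
  then show "ord_of_nat m \<in> conway_of_expansion r0 a"
  proof
    assume "m > r0 \<and> a (m - r0) = 1"
    then obtain k where "m = r0 + k" "k \<ge> 1" "a k = 1"
      by (metis One_nat_def Suc_leI le_add_diff_inverse less_imp_le zero_less_diff)
    then show ?thesis
      by (auto simp: conway_of_expansion_def)
  qed (simp add: conway_of_expansion_def)
qed (auto simp: conway_of_expansion_def split: if_splits)

lemma conway_of_expansion_subset: "conway_of_expansion r0 a \<subseteq> range ord_of_nat \<union> {omega}"
  by (auto simp: conway_of_expansion_def split: if_splits)

lemma omega_in_conway_of_expansion:
  "omega \<in> conway_of_expansion r0 a \<longleftrightarrow> infinite {k. k \<ge> 1 \<and> a k = 1}"
  by (auto simp: conway_of_expansion_def)

text \<open>
  Shifting the index by \<open>r\<^sub>0\<close> identifies the sum over the elements of \<open>x\<close> above its minimum with the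
  sum over the positions of the digits \<open>1\<close>.
\<close>

lemma neg_real_of_conway_of_expansion:
  assumes "binary_expansion r r0 a"
  shows "neg_real_of_conway (conway_of_expansion r0 a) = r"
proof -
  have a: "binary_digits a" "(\<lambda>k. real (a k) * (1 / 2) ^ k) sums (r + real r0)"
    using assms by (auto simp: binary_expansion_iff)
  define X where "X = {m. ord_of_nat m \<in> conway_of_expansion r0 a}"
  have X: "X = {m. m = r0 \<or> m > r0 \<and> a (m - r0) = 1}"
    by (simp add: X_def ord_of_nat_in_conway_of_expansion)
  have least: "(LEAST m. m \<in> X) = r0"
    by (rule Least_equality) (auto simp: X)
  have "((\<lambda>k. real (a k) * (1 / 2) ^ k) has_sum (r + real r0)) UNIV"
    by (rule sums_nonneg_imp_has_sum_strong[OF a(2)]) simp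
  also have "?this \<longleftrightarrow> ((\<lambda>k. (1 / 2) ^ k) has_sum (r + real r0)) {k. a k = 1}"
    using a(1) by (intro has_sum_cong_neutral) (auto simp: binary_digits_def)
  also have "\<dots> \<longleftrightarrow> ((\<lambda>m. (1 / 2) ^ (m - r0)) has_sum (r + real r0)) ((\<lambda>k. r0 + k) ` {k. a k = 1})"
    by (subst has_sum_reindex) (auto simp: o_def)
  also have "(\<lambda>k. r0 + k) ` {k. a k = 1} = {m \<in> X. m > r0}"
  proof (intro equalityI subsetI)
    fix m assume "m \<in> {m \<in> X. m > r0}"
    then show "m \<in> (\<lambda>k. r0 + k) ` {k. a k = 1}"
      by (intro image_eqI[of _ _ "m - r0"]) (auto simp: X)
  next
    fix m assume "m \<in> (\<lambda>k. r0 + k) ` {k. a k = 1}"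
    then obtain k where "m = r0 + k" "a k = 1"
      by auto
    moreover from this have "k > 0"
      using a(1) by (cases k) (auto simp: binary_digits_def)
    ultimately show "m \<in> {m \<in> X. m > r0}"
      by (simp add: X)
  qed
  finally have "(\<Sum>\<^sub>\<infinity>m\<in>{m \<in> X. m > r0}. (1 / 2) ^ (m - r0)) = r + real r0"
    by (rule infsumI)
  then show ?thesis
    unfolding neg_real_of_conway_def Let_def X_def[symmetric] least by simp
qed

lemma conway_of_expansion_short_iff:
  "conway_of_expansion r0 a \<in> short_numbers \<longleftrightarrow> finite {k. k \<ge> 1 \<and> a k = 1}"
proof
  assume "conway_of_expansion r0 a \<in> short_numbers"
  then have "omega \<notin> conway_of_expansion r0 a"
    by (auto simp: short_numbers_def)
  then show "finite {k. k \<ge> 1 \<and> a k = 1}"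
    unfolding omega_in_conway_of_expansion by blast
next
  assume fin: "finite {k. k \<ge> 1 \<and> a k = 1}"
  have "conway_of_expansion r0 a
      = insert (ord_of_nat r0) ((\<lambda>k. ord_of_nat (r0 + k)) ` {k. k \<ge> 1 \<and> a k = 1})"
    using fin by (auto simp: conway_of_expansion_def)
  then show "conway_of_expansion r0 a \<in> short_numbers"
    using fin by (auto simp: short_numbers_def)
qed

text \<open>
  In the infinite case the zeros among the digits, infinite in number, are what makes the natural
  part co-infinite.
\<close>

lemma conway_of_expansion_conway_real:
  assumes "binary_digits a"
  shows "conway_of_expansion r0 a \<in> conway_reals"
proof (cases "finite {k. k \<ge> 1 \<and> a k = 1}")
  case True
  then show ?thesis
    by (simp add: conway_reals_def conway_of_expansion_short_iff)
next
  case False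
  define x where "x = conway_of_expansion r0 a"
  define X where "X = x - {omega}"
  have x: "x = X \<union> {omega}" and X: "X \<subseteq> range ord_of_nat"
    using False omega_in_conway_of_expansion[of r0 a] conway_of_expansion_subset[of r0 a]
    unfolding X_def x_def by auto
  have "(\<lambda>k. ord_of_nat (r0 + k)) ` {k. k \<ge> 1 \<and> a k = 1} \<subseteq> X"
    by (auto simp: X_def x_def ord_of_nat_in_conway_of_expansion)
  moreover have "inj (\<lambda>k. ord_of_nat (r0 + k))"
    by (simp add: inj_def)
  ultimately have "infinite X"
    using False by (meson finite_imageD finite_subset inj_on_subset subset_UNIV)
  have "\<exists>k>n. a k = 0" for n
  proof -
    obtain k where "k \<ge> Suc n" "a k \<noteq> 1"
      using assms unfolding binary_digits_def by blast
    moreover have "a k \<in> {0, 1}"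
      using assms unfolding binary_digits_def by blast
    ultimately show ?thesis
      by (intro exI[of _ k]) auto
  qed
  then have "infinite {k. a k = 0 \<and> k \<ge> 1}"
    unfolding infinite_nat_iff_unbounded
    by (metis (mono_tags, lifting) One_nat_def Suc_leI mem_Collect_eq not_gr_zero not_less_zero)
  moreover have "(\<lambda>k. ord_of_nat (r0 + k)) ` {k. a k = 0 \<and> k \<ge> 1} \<subseteq> range ord_of_nat - X"
    by (auto simp: X_def x_def ord_of_nat_in_conway_of_expansion)
  ultimately have "infinite (range ord_of_nat - X)"
    using \<open>inj (\<lambda>k. ord_of_nat (r0 + k))\<close>
    by (meson finite_imageD finite_subset inj_on_subset subset_UNIV)
  moreover have "conway_number x"
    using X by (auto simp: x conway_number_def intro!: bexI[of _ omega])
  ultimately have "x \<in> long_conway_reals"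
    unfolding long_conway_reals_def using X \<open>infinite X\<close> x by blast
  then show ?thesis
    by (simp add: conway_reals_def x_def)
qed

text \<open>
  The expansion is read off from the minimum and the membership of the later natural numbers.
  Both short and long reals have infinitely many natural numbers missing, so the digits are
  admissible; \<open>0 \<notin> x\<close> gives \<open>r\<^sub>0 \<ge> 1\<close>.
\<close>

lemma conway_real_is_expansion:
  assumes x: "x \<in> conway_reals" and zero: "ord_of_nat 0 \<notin> x"
  obtains r r0 a where "binary_expansion r r0 a" "x = conway_of_expansion r0 a"
proof -
  define X where "X = {m. ord_of_nat m \<in> x}"
  have X_cases: "finite X \<and> X \<noteq> {} \<and> x = ord_of_nat ` X \<or>
    infinite X \<and> infinite (- X) \<and> x = ord_of_nat ` X \<union> {omega}"
    using x unfolding conway_reals_def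
  proof
    assume "x \<in> short_numbers"
    then have "finite x" "x \<noteq> {}" "x \<subseteq> range ord_of_nat"
      by (auto simp: short_numbers_def)
    moreover from this have eq: "x = ord_of_nat ` X"
      by (auto simp: X_def)
    moreover have "finite X"
      using \<open>finite x\<close> eq strict_mono_ord_of_nat
      by (metis finite_imageD inj_on_subset strict_mono_imp_inj_on subset_UNIV)
    ultimately show ?thesis by auto
  next
    assume "x \<in> long_conway_reals"
    then obtain Y where Y: "Y \<subseteq> range ord_of_nat" "infinite Y"
      "infinite (range ord_of_nat - Y)" "x = Y \<union> {omega}"
      by (auto simp: long_conway_reals_def)
    then have "Y = ord_of_nat ` X"
      by (auto simp: X_def)
    moreover from this have "range ord_of_nat - Y \<subseteq> ord_of_nat ` (- X)"
      by auto
    ultimately show ?thesis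
      using Y by (metis finite_imageI finite_subset)
  qed
  define r0 where "r0 = (LEAST m. m \<in> X)"
  define a :: "nat \<Rightarrow> nat" where "a k = of_bool (k \<ge> 1 \<and> r0 + k \<in> X)" for k
  have "X \<noteq> {}"
    using X_cases by auto
  then have r0_X: "r0 \<in> X" and r0_le: "\<And>m. m \<in> X \<Longrightarrow> r0 \<le> m"
    unfolding r0_def by (auto intro: LeastI Least_le)
  have "0 \<notin> X"
    using zero by (simp add: X_def)
  then have "r0 \<ge> 1"
    using r0_X by (metis less_one not_le)
  have not_cofinite: "infinite (- X)"
    using X_cases by (metis finite_compl double_compl infinite_UNIV_nat)
  have "binary_digits a"
    unfolding binary_digits_def
  proof (intro conjI allI notI)
    assume "\<exists>N. \<forall>k\<ge>N. a k = 1"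
    then obtain N where N: "\<forall>k\<ge>N. a k = 1" ..
    have "m \<in> X" if "m \<ge> r0 + N" for m
    proof -
      have "a (m - r0) = 1"
        using N that by simp
      then show ?thesis
        using that by (cases "m \<in> X") (simp_all add: a_def)
    qed
    then have "- X \<subseteq> {..< r0 + N}"
      by (meson ComplD lessThan_iff not_le subsetI)
    with not_cofinite show False
      using finite_subset by blast
  qed (auto simp: a_def)
  then have exp: "binary_expansion ((\<Sum>k. real (a k) * (1 / 2) ^ k) - real r0) r0 a"
    using \<open>r0 \<ge> 1\<close> binary_digits_summable by (simp add: binary_expansion_iff summable_sums)
  have X_iff: "m \<in> X \<longleftrightarrow> m = r0 \<or> m > r0 \<and> a (m - r0) = 1" for m
    using r0_X r0_le[of m] by (auto simp: a_def order.order_iff_strict)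
  have "X = insert r0 ((+) r0 ` {k. k \<ge> 1 \<and> a k = 1})"
  proof (intro equalityI subsetI)
    fix m assume "m \<in> X"
    then consider "m = r0" | "m > r0" "a (m - r0) = 1"
      using X_iff by blast
    then show "m \<in> insert r0 ((+) r0 ` {k. k \<ge> 1 \<and> a k = 1})"
      by cases (auto intro!: image_eqI[of _ _ "m - r0"])
  qed (auto simp: X_iff)
  then have "finite X \<longleftrightarrow> finite {k. k \<ge> 1 \<and> a k = 1}"
    by (simp only: finite_insert finite_image_iff[OF inj_on_add])
  then have "omega \<in> x \<longleftrightarrow> omega \<in> conway_of_expansion r0 a"
    using X_cases unfolding omega_in_conway_of_expansion by auto
  moreover have "ord_of_nat m \<in> x \<longleftrightarrow> ord_of_nat m \<in> conway_of_expansion r0 a" for m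
    using X_iff[of m] by (simp add: X_def ord_of_nat_in_conway_of_expansion)
  moreover have "x \<subseteq> range ord_of_nat \<union> {omega}"
    using X_cases by auto
  ultimately have "x = conway_of_expansion r0 a"
    using conway_of_expansion_subset[of r0 a] by blast
  with exp that show ?thesis by blast
qed

lemma neg_conway_of_real_eq:
  assumes "binary_expansion r r0 a"
  shows "neg_conway_of_real r = conway_of_expansion r0 a"
  unfolding neg_conway_of_real_def
  using assms binary_expansion_unique by (intro the_equality) blast+

lemma zero_notin_conway_of_expansion:
  "binary_expansion r r0 a \<Longrightarrow> ord_of_nat 0 \<notin> conway_of_expansion r0 a"
  by (auto simp: ord_of_nat_in_conway_of_expansion binary_expansion_def)

lemma neg_conway_of_real:
  assumes "r < 0"
  shows "neg_conway_of_real r \<in> conway_reals" "ord_of_nat 0 \<notin> neg_conway_of_real r"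
    "neg_real_of_conway (neg_conway_of_real r) = r"
    "neg_conway_of_real r \<in> short_numbers \<longleftrightarrow> r \<in> dyadic_rationals"
proof -
  obtain r0 a where e: "binary_expansion r r0 a"
    using assms by (rule ex_binary_expansion)
  then have "binary_digits a"
    by (simp add: binary_expansion_iff)
  with e show "neg_conway_of_real r \<in> conway_reals" "ord_of_nat 0 \<notin> neg_conway_of_real r"
    "neg_real_of_conway (neg_conway_of_real r) = r"
    "neg_conway_of_real r \<in> short_numbers \<longleftrightarrow> r \<in> dyadic_rationals"
    using conway_of_expansion_conway_real zero_notin_conway_of_expansion
      neg_real_of_conway_of_expansion conway_of_expansion_short_iff dyadic_iff_finite_expansion
    by (simp_all add: neg_conway_of_real_eq)
qed

lemma neg_real_of_conway:
  assumes "x \<in> conway_reals" "ord_of_nat 0 \<notin> x"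
  shows "neg_real_of_conway x < 0" "neg_conway_of_real (neg_real_of_conway x) = x"
proof -
  obtain r r0 a where "binary_expansion r r0 a" "x = conway_of_expansion r0 a"
    using conway_real_is_expansion assms .
  then show "neg_real_of_conway x < 0" "neg_conway_of_real (neg_real_of_conway x) = x"
    by (simp_all add: neg_real_of_conway_of_expansion neg_conway_of_real_eq
        binary_expansion_negative)
qed

section \<open>Extension to all Conway reals by the opposite\<close>

lemma singleton_zero_real: "{ord_of_nat 0} \<in> conway_reals"
  by (simp add: conway_reals_def short_numbers_def)

text \<open>
  The case distinction negative, zero, positive, on the side of the numbers.
\<close>

lemma conway_real_cases:
  assumes "x \<in> conway_reals"
  obtains "x = {ord_of_nat 0}"
  | "ord_of_nat 0 \<notin> x"
  | y where "y \<in> conway_reals" "ord_of_nat 0 \<notin> y" "x = opposite y"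
proof (cases "x = {ord_of_nat 0} \<or> ord_of_nat 0 \<notin> x")
  case False
  have num: "conway_number x"
    using assms by (rule conway_real_is_number)
  show ?thesis
  proof (rule that(3))
    show "opposite x \<in> conway_reals"
      using assms by (rule opposite_conway_real)
    show "ord_of_nat 0 \<notin> opposite x"
      using False num zero_in_opposite_iff by blast
    show "x = opposite (opposite x)"
      using num opposite_opposite by simp
  qed
qed (use that in blast)

lemma real_of_conway_neg: "ord_of_nat 0 \<notin> x \<Longrightarrow> real_of_conway x = neg_real_of_conway x"
  by (simp add: real_of_conway_def)

text \<open>
  The opposite of \<open>y\<close> cannot be \<open>{0}\<close>: it has the birthday of \<open>y\<close>, an element of \<open>y\<close> and hence
  not \<open>0\<close>.
\<close>

lemma opposite_nonzero:
  assumes "y \<in> conway_reals" "ord_of_nat 0 \<notin> y"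
  shows "ord_of_nat 0 \<in> opposite y" "opposite y \<noteq> {ord_of_nat 0}"
proof -
  have num: "conway_number y"
    using assms(1) by (rule conway_real_is_number)
  moreover have "y \<noteq> {ord_of_nat 0}"
    using assms(2) by auto
  ultimately show "ord_of_nat 0 \<in> opposite y"
    using assms(2) zero_in_opposite_iff by blast
  have "birthday {ord_of_nat 0} = ord_of_nat 0"
    by (rule birthday_eqI) auto
  moreover have "birthday y \<in> y"
    using num unfolding conway_number_def by (metis birthday_eqI)
  ultimately show "opposite y \<noteq> {ord_of_nat 0}"
    using assms(2) birthday_opposite[of y] by metis
qed

lemma real_of_conway_opposite:
  assumes "x \<in> conway_reals"
  shows "real_of_conway (opposite x) = - real_of_conway x"
  using assms
proof (cases rule: conway_real_cases)
  case 1
  have "opposite {ord_of_nat 0} = {ord_of_nat 0}"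
    by (auto simp: opposite_singleton conway_ord_def intro: order_antisym ord_of_nat_0_le)
  with 1 show ?thesis by (simp add: real_of_conway_def)
next
  case 2
  then show ?thesis
    using assms opposite_nonzero conway_real_is_number
    by (simp add: real_of_conway_def opposite_opposite)
next
  case (3 y)
  then show ?thesis
    using opposite_nonzero conway_real_is_number
    by (simp add: real_of_conway_def opposite_opposite)
qed

lemma conway_of_real_conway_real: "conway_of_real r \<in> conway_reals"
  using neg_conway_of_real(1) opposite_conway_real singleton_zero_real
  by (simp add: conway_of_real_def)

lemma conway_of_real_short_iff: "conway_of_real r \<in> short_numbers \<longleftrightarrow> r \<in> dyadic_rationals"
proof -
  consider "r < 0" | "r = 0" | "r > 0" by linarith
  then show ?thesis
  proof cases
    case 1
    then show ?thesis by (simp add: conway_of_real_def neg_conway_of_real)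
  next
    case 2
    have "0 \<in> dyadic_rationals"
      unfolding dyadic_rationals_def by (auto intro: exI[of _ 0])
    with 2 show ?thesis by (simp add: conway_of_real_def short_numbers_def)
  next
    case 3
    let ?y = "neg_conway_of_real (- r)"
    have "?y \<in> conway_reals"
      using 3 neg_conway_of_real by simp
    then have "opposite ?y \<in> short_numbers \<longleftrightarrow> ?y \<in> short_numbers"
      using opposite_short opposite_opposite conway_real_is_number by metis
    also have "\<dots> \<longleftrightarrow> r \<in> dyadic_rationals"
      using 3 dyadic_rationals_minus[of r] dyadic_rationals_minus[of "- r"]
      by (auto simp: neg_conway_of_real)
    finally show ?thesis
      using 3 by (simp add: conway_of_real_def)
  qed
qed

lemma real_of_conway_of_real: "real_of_conway (conway_of_real r) = r"
proof -
  consider "r < 0" | "r = 0" | "r > 0" by linarith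
  then show ?thesis
  proof cases
    case 1
    then show ?thesis
      by (simp add: conway_of_real_def real_of_conway_neg neg_conway_of_real)
  next
    case 2
    then show ?thesis
      by (simp add: conway_of_real_def real_of_conway_def)
  next
    case 3
    then show ?thesis
      by (simp add: conway_of_real_def real_of_conway_opposite real_of_conway_neg neg_conway_of_real)
  qed
qed

lemma conway_of_real_of_conway:
  assumes "x \<in> conway_reals"
  shows "conway_of_real (real_of_conway x) = x"
  using assms
proof (cases rule: conway_real_cases)
  case 1
  then show ?thesis by (simp add: real_of_conway_def conway_of_real_def)
next
  case 2
  then show ?thesis
    using assms by (simp add: real_of_conway_neg conway_of_real_def neg_real_of_conway)
next
  case (3 y)
  then have "real_of_conway x = - neg_real_of_conway y"
    by (simp add: real_of_conway_opposite real_of_conway_neg)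
  with 3 show ?thesis
    using neg_real_of_conway[of y] by (simp add: conway_of_real_def)
qed

lemma real_of_conway_short_numbers: "real_of_conway ` short_numbers = dyadic_rationals"
proof (intro equalityI subsetI)
  fix r assume "r \<in> real_of_conway ` short_numbers"
  then obtain x where "x \<in> short_numbers" "r = real_of_conway x"
    by auto
  then show "r \<in> dyadic_rationals"
    using conway_of_real_of_conway[of x] conway_of_real_short_iff[of r]
    by (simp add: conway_reals_def)
next
  fix r assume "r \<in> dyadic_rationals"
  then show "r \<in> real_of_conway ` short_numbers"
    using conway_of_real_short_iff real_of_conway_of_real by (metis image_eqI)
qed

section \<open>Values of singletons and of finite Conway ordinals\<close>

text \<open>
  The expansion of \<open>-n\<close> is \<open>r\<^sub>0 = n\<close> with all digits \<open>0\<close>.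
\<close>

lemma real_of_conway_singleton: "real_of_conway {ord_of_nat n} = - real n"
proof (cases "n = 0")
  case True
  then show ?thesis by (simp add: real_of_conway_def)
next
  case False
  have "binary_expansion (- real n) n (\<lambda>_. 0)"
    using False by (auto simp: binary_expansion_def intro: exI order_refl)
  then have "neg_real_of_conway (conway_of_expansion n (\<lambda>_. 0)) = - real n"
    by (rule neg_real_of_conway_of_expansion)
  moreover have "conway_of_expansion n (\<lambda>_. 0) = {ord_of_nat n}"
    by (simp add: conway_of_expansion_def)
  ultimately show ?thesis
    using False by (simp add: real_of_conway_neg)
qed

lemma real_of_conway_ord: "real_of_conway (conway_ord (ord_of_nat n)) = real n"
proof -
  have "{ord_of_nat n} \<in> conway_reals"
    by (simp add: conway_reals_def short_numbers_def)
  then show ?thesis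
    using real_of_conway_opposite[of "{ord_of_nat n}"]
    by (simp add: opposite_singleton real_of_conway_singleton)
qed

section \<open>The correspondence\<close>

theorem theorem2p16:
  shows
    "(\<forall>x\<in>conway_reals. ord_of_nat 0 \<in> x \<longrightarrow> real_of_conway x = - real_of_conway (opposite x)) \<and>
     (\<forall>r<0. \<exists>!(r0, a). binary_expansion r r0 a) \<and>
     bij_betw real_of_conway conway_reals UNIV \<and>
     bij_betw conway_of_real UNIV conway_reals \<and>
     (\<forall>x\<in>conway_reals. conway_of_real (real_of_conway x) = x) \<and>
     (\<forall>r. real_of_conway (conway_of_real r) = r) \<and>
     real_of_conway ` short_numbers = dyadic_rationals \<and>
     real_of_conway ` finite_conway_ordinals = \<nat> \<and>
     (\<forall>n. real_of_conway (conway_ord (ord_of_nat n)) = real n) \<and>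
     (\<forall>n. real_of_conway {ord_of_nat n} = - real n) \<and>
     (\<forall>x\<in>finite_conway_ordinals. \<forall>y\<in>finite_conway_ordinals.
        conway_ord_add x y \<in> finite_conway_ordinals \<and>
        real_of_conway (conway_ord_add x y) = real_of_conway x + real_of_conway y) \<and>
     (\<forall>x\<in>finite_conway_ordinals. \<forall>y\<in>finite_conway_ordinals.
        conway_ord_mult x y \<in> finite_conway_ordinals \<and>
        real_of_conway (conway_ord_mult x y) = real_of_conway x * real_of_conway y)"
proof (intro conjI)
  show "\<forall>x\<in>conway_reals. ord_of_nat 0 \<in> x \<longrightarrow> real_of_conway x = - real_of_conway (opposite x)"
    by (simp add: real_of_conway_opposite)
  show "\<forall>r<0. \<exists>!(r0, a). binary_expansion r r0 a"
  proof (intro allI impI)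
    fix r :: real assume "r < 0"
    then obtain r0 a where "binary_expansion r r0 a"
      by (rule ex_binary_expansion)
    then show "\<exists>!(r0, a). binary_expansion r r0 a"
      using binary_expansion_unique by (intro ex1I[of _ "(r0, a)"]) blast+
  qed
  show "bij_betw real_of_conway conway_reals UNIV"
    by (rule bij_betw_byWitness[where f' = conway_of_real])
      (auto simp: conway_of_real_of_conway real_of_conway_of_real conway_of_real_conway_real)
  show "bij_betw conway_of_real UNIV conway_reals"
    by (rule bij_betw_byWitness[where f' = real_of_conway])
      (auto simp: conway_of_real_of_conway real_of_conway_of_real conway_of_real_conway_real)
  show "\<forall>x\<in>conway_reals. conway_of_real (real_of_conway x) = x"
    by (simp add: conway_of_real_of_conway)
  show "\<forall>r. real_of_conway (conway_of_real r) = r"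
    by (simp add: real_of_conway_of_real)
  show "real_of_conway ` short_numbers = dyadic_rationals"
    by (rule real_of_conway_short_numbers)
  show "real_of_conway ` finite_conway_ordinals = \<nat>"
    by (simp add: finite_conway_ordinals_eq image_image real_of_conway_ord Nats_def)
  show "\<forall>n. real_of_conway (conway_ord (ord_of_nat n)) = real n"
    by (simp add: real_of_conway_ord)
  show "\<forall>n. real_of_conway {ord_of_nat n} = - real n"
    by (simp add: real_of_conway_singleton)
qed (auto simp: finite_conway_ordinals_eq conway_ord_add conway_ord_mult ord_add_of_nat
      ord_mult_of_nat real_of_conway_ord)

end
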